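(* Let $\mathbf I=(I,\vee,\wedge,\rightarrow,1)$ be a non-classical implication semilattice and define a ternary operation $r$ on $I$ by $r(x,y,z):=(x\vee z)\wedge(y\vee z)$ for all $x,y,z\in I$. Then $\mathbb A(\mathbf I):=(I,\vee,r,\rightarrow,1)$ is an I-algebra.
   Context: In a join-semilattice $(S,\vee,1)$ with top element $1$, the order is $x\leq y$ iff $x\vee y=y$. Throughout, $x\wedge y$ denotes the infimum of $x$ and $y$, a partial operation. A non-classical implication semilattice is a quintuple $(S,\vee,\wedge,\rightarrow,1)$ where $(S,\vee,1)$ is a join-semilattice with top element $1$, the infimum $x\wedge y$ exists if and only if $x$ and $y$ have a common lower bound, and $\rightarrow$ is a binary operation on $S$ such that for all $x,y,z\in S$: (1) $y\leq x\rightarrow y$; (2) $(x\vee y)\wedge(x\rightarrow y)=y$; (3) $(x\vee y)\rightarrow y=x\rightarrow y$; (4) $y\leq(x\vee z)\rightarrow\big((x\vee z)\wedge(y\vee z)\big)$. An I-algebra is an algebra $(A,\vee,r,\rightarrow,1)$ of type $(2,3,2,0)$ such that $(A,\vee,1)$ is a join-semilattice with top element $1$ and for all $x,y,z,u\in A$: (1') $y\leq x\rightarrow y$; (2') $r(x,x\rightarrow y,y)=y$; (3') $(x\vee y)\rightarrow y=x\rightarrow y$; (4') $y\leq(x\vee z)\rightarrow r(x,y,z)$; (5') $r(x,y,z)\leq x\vee z$; (6') $r(x,y,z)\leq y\vee z$; (7') $r(x,x\vee y,z)=x\vee z$; (8') $r(x,y,z)=r(x\vee z,y\vee z,z)$;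 (9') $z\leq r(x,y,z)$; (10') $r(u,r(x,y,z),z)=r(r(u,x,z),r(u,y,z),z)$. *)

theory Defs
  imports Main
begin

text \<open>
  The universe of each algebra is the whole (arbitrary) type; the library locale
  \<open>semilattice\<close> says that \<open>join\<close> is associative, commutative and idempotent.
\<close>

locale join_semilattice_top = semilattice join
  for join :: "'a \<Rightarrow> 'a \<Rightarrow> 'a"  (infixl \<open>\<squnion>\<close> 65) +
  fixes one :: 'a  (\<open>\<one>\<close>)
  assumes join_one: "x \<squnion> \<one> = \<one>"
begin

definition le :: "'a \<Rightarrow> 'a \<Rightarrow> bool"  (infix \<open>\<sqsubseteq>\<close> 50)
  where "x \<sqsubseteq> y \<longleftrightarrow> x \<squnion> y = y"

definition is_infimum :: "'a \<Rightarrow> 'a \<Rightarrow> 'a \<Rightarrow> bool"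
  where "is_infimum x y m \<longleftrightarrow> m \<sqsubseteq> x \<and> m \<sqsubseteq> y \<and> (\<forall>w. w \<sqsubseteq> x \<and> w \<sqsubseteq> y \<longrightarrow> w \<sqsubseteq> m)"

end

text \<open>
  The partial operation \<open>meet\<close> is option-valued, with \<open>None\<close> for ``undefined''.
  In \<open>ax4\<close> the term under \<open>the\<close> is always defined, since \<open>z\<close> is a common lower
  bound of its two arguments; this is \<open>meet_join_join_defined\<close> below.
\<close>

locale nonclassical_implication_semilattice = join_semilattice_top join one
  for join :: "'a \<Rightarrow> 'a \<Rightarrow> 'a"  (infixl \<open>\<squnion>\<close> 65)
    and meet :: "'a \<Rightarrow> 'a \<Rightarrow> 'a option"  (infixl \<open>\<sqinter>\<close> 70)
    and imp :: "'a \<Rightarrow> 'a \<Rightarrow> 'a"  (infixr \<open>\<rightarrow>\<close> 60)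
    and one :: 'a  (\<open>\<one>\<close>) +
  assumes meet_eq_Some_iff: "x \<sqinter> y = Some m \<longleftrightarrow> is_infimum x y m"
    and meet_defined_iff: "(\<exists>m. x \<sqinter> y = Some m) \<longleftrightarrow> (\<exists>w. w \<sqsubseteq> x \<and> w \<sqsubseteq> y)"
    and ax1: "y \<sqsubseteq> (x \<rightarrow> y)"
    and ax2: "(x \<squnion> y) \<sqinter> (x \<rightarrow> y) = Some y"
    and ax3: "((x \<squnion> y) \<rightarrow> y) = (x \<rightarrow> y)"
    and ax4: "y \<sqsubseteq> ((x \<squnion> z) \<rightarrow> the ((x \<squnion> z) \<sqinter> (y \<squnion> z)))"
begin

lemma meet_join_join_defined:
  "(x \<squnion> z) \<sqinter> (y \<squnion> z) = Some (the ((x \<squnion> z) \<sqinter> (y \<squnion> z)))"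
proof -
  have "z \<sqsubseteq> v \<squnion> z" for v
    by (simp add: le_def left_commute)
  then have "\<exists>m. (x \<squnion> z) \<sqinter> (y \<squnion> z) = Some m"
    unfolding meet_defined_iff by blast
  then show ?thesis by auto
qed

end

locale I_algebra = join_semilattice_top join one
  for join :: "'a \<Rightarrow> 'a \<Rightarrow> 'a"  (infixl \<open>\<squnion>\<close> 65)
    and r :: "'a \<Rightarrow> 'a \<Rightarrow> 'a \<Rightarrow> 'a"
    and imp :: "'a \<Rightarrow> 'a \<Rightarrow> 'a"  (infixr \<open>\<rightarrow>\<close> 60)
    and one :: 'a  (\<open>\<one>\<close>) +
  assumes I1: "y \<sqsubseteq> (x \<rightarrow> y)"
    and I2: "r x (x \<rightarrow> y) y = y"
    and I3: "((x \<squnion> y) \<rightarrow> y) = (x \<rightarrow> y)"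
    and I4: "y \<sqsubseteq> ((x \<squnion> z) \<rightarrow> r x y z)"
    and I5: "r x y z \<sqsubseteq> x \<squnion> z"
    and I6: "r x y z \<sqsubseteq> y \<squnion> z"
    and I7: "r x (x \<squnion> y) z = x \<squnion> z"
    and I8: "r x y z = r (x \<squnion> z) (y \<squnion> z) z"
    and I9: "z \<sqsubseteq> r x y z"
    and I10: "r u (r x y z) z = r (r u x z) (r u y z) z"

end

theory Submission
  imports Defs
begin

context join_semilattice_top
begin

lemma le_refl: "x \<sqsubseteq> x"
  by (simp add: le_def)

lemma le_antisym: "x \<sqsubseteq> y \<Longrightarrow> y \<sqsubseteq> x \<Longrightarrow> x = y"
  by (metis le_def commute)

lemma le_trans: "x \<sqsubseteq> y \<Longrightarrow> y \<sqsubseteq> z \<Longrightarrow> x \<sqsubseteq> z"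
  by (metis le_def assoc)

lemma le_joinI1: "x \<sqsubseteq> x \<squnion> y"
  by (simp add: le_def)

lemma le_joinI2: "y \<sqsubseteq> x \<squnion> y"
  by (simp add: le_def left_commute)

lemma join_absorb_le: "y \<sqsubseteq> x \<Longrightarrow> x \<squnion> y = x"
  by (simp add: le_def commute)

lemma eq_iff_same_lower_bounds: "x = y \<longleftrightarrow> (\<forall>w. w \<sqsubseteq> x \<longleftrightarrow> w \<sqsubseteq> y)"
  by (metis le_refl le_antisym)

end

context nonclassical_implication_semilattice
begin

text \<open>Since \<open>z\<close> is a common lower bound of the two joins, \<open>the\<close> is
  applied to a defined meet, which has the universal property of an infimum.\<close>

lemma le_the_meet_iff:
  "w \<sqsubseteq> the ((x \<squnion> z) \<sqinter> (y \<squnion> z)) \<longleftrightarrow> w \<sqsubseteq> x \<squnion> z \<and> w \<sqsubseteq> y \<squnion> z"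
proof -
  have "is_infimum (x \<squnion> z) (y \<squnion> z) (the ((x \<squnion> z) \<sqinter> (y \<squnion> z)))"
    using meet_join_join_defined meet_eq_Some_iff by blast
  then show ?thesis
    unfolding is_infimum_def using le_trans by blast
qed

end

text \<open>
  For fixed \<open>z\<close> the elements above \<open>z\<close> form a lattice, and \<open>r x y z\<close> is the meet of the
  images of \<open>x\<close> and \<open>y\<close> under the retraction \<open>v \<mapsto> v \<squnion> z\<close> onto it. The identities for
  \<open>r\<close> thus reduce to comparing lower bounds.
\<close>

theorem theorem5p2:
  fixes join :: "'a \<Rightarrow> 'a \<Rightarrow> 'a"
    and meet :: "'a \<Rightarrow> 'a \<Rightarrow> 'a option"
    and imp :: "'a \<Rightarrow> 'a \<Rightarrow> 'a"
    and one :: 'a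
    and r :: "'a \<Rightarrow> 'a \<Rightarrow> 'a \<Rightarrow> 'a"
  assumes "nonclassical_implication_semilattice join meet imp one"
    and "\<And>x y z. r x y z = the (meet (join x z) (join y z))"
  shows "I_algebra join r imp one"
proof -
  interpret nonclassical_implication_semilattice join meet imp one
    by (fact assms(1))
  have le_r_iff: "le w (r x y z) \<longleftrightarrow> le w (join x z) \<and> le w (join y z)" for w x y z
    by (simp add: assms(2) le_the_meet_iff)
  have le_r: "le z (r x y z)" for x y z
    by (simp add: le_r_iff le_joinI2)
  have r_join: "join (r x y z) z = r x y z" for x y z
    by (simp add: join_absorb_le le_r)
  show ?thesis
  proof unfold_locales
    fix x y z u
    show "le y (imp x y)"
      by (fact ax1)
    \<comment> \<open>By \<open>ax1\<close> the second join \<open>join (imp x y) y\<close>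
      collapses to \<open>imp x y\<close>, leaving exactly the meet in \<open>ax2\<close>.\<close>
    show "r x (imp x y) y = y"
      using ax1 ax2 by (simp add: assms(2) join_absorb_le)
    show "imp (join x y) y = imp x y"
      by (fact ax3)
    show "le y (imp (join x z) (r x y z))"
      using ax4 by (simp add: assms(2))
    show "le (r x y z) (join x z)" "le (r x y z) (join y z)"
      using le_r_iff le_refl by blast+
    \<comment> \<open>The two elements whose meet is taken are comparable, so the meet is the
      smaller one.\<close>
    have "le (join x z) (join (join x y) z)"
      by (metis le_joinI1 assoc commute)
    then show "r x (join x y) z = join x z"
      unfolding eq_iff_same_lower_bounds le_r_iff using le_trans by blast
    show "r x y z = r (join x z) (join y z) z"
      by (simp add: assms(2) assoc)
    show "le z (r x y z)"
      by (fact le_r)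
    \<comment> \<open>By \<open>r_join\<close> the inner values of \<open>r\<close> absorb the outer
      join with \<open>z\<close>. Then \<open>w\<close> lies below either side iff it lies below the
      joins of \<open>u\<close>, \<open>x\<close> and \<open>y\<close> with
      \<open>z\<close>.\<close>
    show "r u (r x y z) z = r (r u x z) (r u y z) z"
      unfolding eq_iff_same_lower_bounds le_r_iff r_join by blast
  qed
qed

end
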